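(* There are contextuality scenarios $H$ for which $\mathcal{Q}_1(H)\subsetneq\mathcal{CE}^\infty(H)$.
   Context: A contextuality scenario is a hypergraph $H$ with finite nonempty vertex set $V(H)$ and edge set $E(H)\subseteq 2^{V(H)}$ such that $\bigcup_{e\in E(H)}e=V(H)$. A probabilistic model on $H$ is a map $p:V(H)\to[0,1]$ with $\sum_{v\in e}p(v)=1$ for all $e\in E(H)$; $\mathcal{G}(H)$ is the set of these. For $u,v\in V(H)$ write $u\perp v$ if $u\neq v$ and some edge contains both. The non-orthogonality graph $\mathrm{NO}(H)$ is the simple graph on $V(H)$ in which distinct $u,v$ are adjacent iff $u\not\perp v$. $\mathcal{Q}_1(H)$ is the set of $p:V(H)\to[0,1]$ for which there is a positive semidefinite complex matrix $M$ with rows and columns indexed by $V(H)\cup\{\emptyset\}$ ($\emptyset$ being an extra index symbol) such that $M_{\emptyset,\emptyset}=1$; $\sum_{x\in e}M_{x,w}=M_{\emptyset,w}$ for all $e\in E(H)$ and all $w\in V(H)\cup\{\emptyset\}$; $M_{u,v}=0$ whenever $u\perp v$; and $p(v)=M_{v,\emptyset}$ for all $v\in V(H)$. The Foulis–Randall product $H_A\otimes H_B$ has vertex set $V(H_A)\times V(H_B)$ and as edges all sets $\bigcup_{a\in e_A}\{a\}\times f(a)$ with $e_A\in E(H_A)$, $f:e_A\to E(H_B)$, and all sets $\bigcup_{b\in e_B}f(b)\times\{b\}$ with $e_B\in E(H_B)$, $f:e_B\to E(H_A)$. $H^{\otimes n}$ is the iterated binary Foulis–Randall product of $n$ copies of $H$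 (with any fixed bracketing), with vertex set identified with $V(H)^n$, and $p^{\otimes n}(v_1,\dots,v_n)=p(v_1)\cdots p(v_n)$. $\mathcal{CE}^1(H)$ is the set of $p\in\mathcal{G}(H)$ with $\sum_{v\in I}p(v)\leq 1$ for every independent set $I$ of $\mathrm{NO}(H)$. $p\in\mathcal{CE}^n(H)$ iff $p^{\otimes n}\in\mathcal{CE}^1(H^{\otimes n})$; $\mathcal{CE}^\infty(H)=\bigcap_{n\geq1}\mathcal{CE}^n(H)$. *)

theory Defs
  imports "HOL-Analysis.Analysis"
begin

record 'a hypergraph =
  verts :: "'a set"
  edges :: "'a set set"

definition contextuality_scenario :: "'a hypergraph \<Rightarrow> bool" where
  "contextuality_scenario H \<longleftrightarrow>
     finite (verts H) \<and> verts H \<noteq> {} \<and> edges H \<subseteq> Pow (verts H) \<and> \<Union>(edges H) = verts H"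

text \<open>
  Maps on the vertex set are extensional functions (\<open>\<rightarrow>\<^sub>E\<close>), so that different
  elements of the sets of functions below differ somewhere on the vertex set.
\<close>

definition prob_models :: "'a hypergraph \<Rightarrow> ('a \<Rightarrow> real) set" where
  "prob_models H = {p \<in> verts H \<rightarrow>\<^sub>E {0..1}. \<forall>e\<in>edges H. (\<Sum>v\<in>e. p v) = 1}"

definition orthogonal_in :: "'a hypergraph \<Rightarrow> 'a \<Rightarrow> 'a \<Rightarrow> bool" where
  "orthogonal_in H u v \<longleftrightarrow> u \<noteq> v \<and> (\<exists>e\<in>edges H. u \<in> e \<and> v \<in> e)"

text \<open>A simple graph is represented as a hypergraph all of whose edges have two elements.\<close>

definition NO :: "'a hypergraph \<Rightarrow> 'a hypergraph" where
  "NO H = \<lparr>verts = verts H,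
           edges = {{u, v} | u v. u \<in> verts H \<and> v \<in> verts H \<and> u \<noteq> v \<and> \<not> orthogonal_in H u v}\<rparr>"

definition independent_vertices :: "'a hypergraph \<Rightarrow> 'a set \<Rightarrow> bool" where
  "independent_vertices G I \<longleftrightarrow> I \<subseteq> verts G \<and> (\<forall>u\<in>I. \<forall>v\<in>I. {u, v} \<notin> edges G)"

definition pos_semidef_on :: "'i set \<Rightarrow> ('i \<Rightarrow> 'i \<Rightarrow> complex) \<Rightarrow> bool" where
  "pos_semidef_on J M \<longleftrightarrow>
     (\<forall>i\<in>J. \<forall>j\<in>J. M j i = cnj (M i j)) \<and>
     (\<forall>x. (\<Sum>i\<in>J. \<Sum>j\<in>J. cnj (x i) * M i j * x j) \<in> \<real>\<^sub>\<ge>\<^sub>0)"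

text \<open>The extra index symbol is \<^const>\<open>None\<close>; a vertex \<open>v\<close> is the index \<open>Some v\<close>.\<close>

definition Q1 :: "'a hypergraph \<Rightarrow> ('a \<Rightarrow> real) set" where
  "Q1 H = {p \<in> verts H \<rightarrow>\<^sub>E {0..1}.
     \<exists>M :: 'a option \<Rightarrow> 'a option \<Rightarrow> complex.
       pos_semidef_on (insert None (Some ` verts H)) M \<and>
       M None None = 1 \<and>
       (\<forall>e\<in>edges H. \<forall>w\<in>insert None (Some ` verts H). (\<Sum>x\<in>e. M (Some x) w) = M None w) \<and>
       (\<forall>u\<in>verts H. \<forall>v\<in>verts H. orthogonal_in H u v \<longrightarrow> M (Some u) (Some v) = 0) \<and>
       (\<forall>v\<in>verts H. complex_of_real (p v) = M (Some v) None)}"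

definition FR_product :: "'a hypergraph \<Rightarrow> 'b hypergraph \<Rightarrow> ('a \<times> 'b) hypergraph" where
  "FR_product A B = \<lparr>verts = verts A \<times> verts B,
     edges = {(\<Union>a\<in>eA. {a} \<times> f a) | eA f. eA \<in> edges A \<and> f \<in> eA \<rightarrow> edges B}
           \<union> {(\<Union>b\<in>eB. f b \<times> {b}) | eB f. eB \<in> edges B \<and> f \<in> eB \<rightarrow> edges A}\<rparr>"

definition relabel :: "('a \<Rightarrow> 'b) \<Rightarrow> 'a hypergraph \<Rightarrow> 'b hypergraph" where
  "relabel g H = \<lparr>verts = g ` verts H, edges = (\<lambda>e. g ` e) ` edges H\<rparr>"

text \<open>
  Powers are bracketed to the right, and \<open>n\<close>-tuples of vertices are lists of length \<open>n\<close>.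
  The value at \<open>0\<close> is a dummy: only powers with \<open>n \<ge> 1\<close> are used.
\<close>

fun FR_power :: "'a hypergraph \<Rightarrow> nat \<Rightarrow> 'a list hypergraph" where
  "FR_power H 0 = \<lparr>verts = {[]}, edges = {{[]}}\<rparr>"
| "FR_power H (Suc 0) = relabel (\<lambda>v. [v]) H"
| "FR_power H (Suc (Suc n)) = relabel (\<lambda>(v, vs). v # vs) (FR_product H (FR_power H (Suc n)))"

lemma verts_FR_power: "verts (FR_power H n) = {vs. set vs \<subseteq> verts H \<and> length vs = n}"
proof (induction H n rule: FR_power.induct)
  case (2 H)
  show ?case by (auto simp: relabel_def length_Suc_conv)
next
  case (3 H n)
  then show ?case
    by (auto simp: relabel_def FR_product_def length_Suc_conv image_iff)
qed auto

definition model_power :: "'a hypergraph \<Rightarrow> ('a \<Rightarrow> real) \<Rightarrow> nat \<Rightarrow> 'a list \<Rightarrow> real" where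
  "model_power H p n = (\<lambda>vs\<in>{vs. set vs \<subseteq> verts H \<and> length vs = n}. \<Prod>v\<leftarrow>vs. p v)"

definition CE1 :: "'a hypergraph \<Rightarrow> ('a \<Rightarrow> real) set" where
  "CE1 H = {p \<in> prob_models H. \<forall>I. independent_vertices (NO H) I \<longrightarrow> (\<Sum>v\<in>I. p v) \<le> 1}"

definition CE :: "nat \<Rightarrow> 'a hypergraph \<Rightarrow> ('a \<Rightarrow> real) set" where
  "CE n H = {p \<in> prob_models H. model_power H p n \<in> CE1 (FR_power H n)}"

definition CE_inf :: "'a hypergraph \<Rightarrow> ('a \<Rightarrow> real) set" where
  "CE_inf H = (\<Inter>n\<in>{1..}. CE n H)"

end

theory Submission
  imports Defs
begin

text \<open>
  Let the vertices be vectors of the Lorentzian lattice \<open>\<int>\<^bsup>1,6\<^esup>\<close> and the edges be orthogonal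
  bases, so that the constant model \<open>1/7\<close> is a probabilistic model.
  Haemers' rank argument applies to the tensor powers: pairwise orthogonal product vectors
  of nonzero norm are linearly independent, so an independent set of \<open>NO(H\<^bsup>\<otimes>n\<^esup>)\<close> has at most
  \<open>7\<^bsup>n\<^esup>\<close> elements, and the model lies in \<open>\<C>\<E>\<^bsup>\<infinity>\<^esup>\<close>.
  The vectors contain the classes of the 27 lines on a smooth cubic surface, where \<open>\<perp>\<close> means
  skew.  Their intersection graph has Lovasz number \<open>9 > 7\<close>, so the model is not in \<open>\<Q>\<^sub>1\<close>; the
  dual certificate is the kernel \<open>1 - 3 \<langle>u,v\<rangle>\<close>.  It is positive semidefinite because every line
  has \<open>\<langle>u,\<kappa>\<rangle> = 1\<close> for the anticanonical class \<open>\<kappa>\<close>, of norm 3, so that the kernel is \<open>-3\<close> times the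
  form of the projections to the complement of \<open>\<kappa>\<close>, where the form is negative definite.
  The inclusion \<open>\<Q>\<^sub>1 \<subseteq> \<C>\<E>\<^bsup>\<infinity>\<^esup>\<close> holds for every scenario, by multiplicativity of the
  Lovasz bound: tensor powers of a Gram representation of \<open>M\<close> are again orthogonal
  representations.
\<close>

section \<open>Powers of scenarios\<close>

text \<open>In the form \<open>Sigma eA f\<close>, up to a swap, an edge can be summed over by
  \<open>sum.Sigma\<close>, one party after the other.\<close>

lemma edges_FR_productE:
  assumes "e \<in> edges (FR_product A B)"
  obtains eA f where "eA \<in> edges A" "f \<in> eA \<rightarrow> edges B" "e = Sigma eA f"
    | eB f where "eB \<in> edges B" "f \<in> eB \<rightarrow> edges A" "e = prod.swap ` Sigma eB f"
proof -
  have 1: "(\<Union>a\<in>eA. {a} \<times> f a) = Sigma eA f" for eA :: "'a set" and f :: "'a \<Rightarrow> 'b set"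
    by auto
  have 2: "(\<Union>b\<in>eB. f b \<times> {b}) = prod.swap ` Sigma eB f" for eB :: "'b set" and f :: "'b \<Rightarrow> 'a set"
    by force
  have "(\<exists>eA f. e = Sigma eA f \<and> eA \<in> edges A \<and> f \<in> eA \<rightarrow> edges B) \<or>
      (\<exists>eB f. e = prod.swap ` Sigma eB f \<and> eB \<in> edges B \<and> f \<in> eB \<rightarrow> edges A)"
    using assms unfolding FR_product_def 1 2 by simp
  then show thesis
    by (elim disjE exE conjE) (rule that(1), assumption+, rule that(2), assumption+)
qed

text \<open>If the first components agree, both second components lie in the one edge
  \<open>f (fst x)\<close> and differ there; otherwise the first components are distinct members of
  \<open>eA\<close>. The second kind of edge is symmetric.\<close>

lemma orthogonal_in_FR_product:
  assumes "orthogonal_in (FR_product A B) x y"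
  shows "orthogonal_in A (fst x) (fst y) \<or> orthogonal_in B (snd x) (snd y)"
proof -
  from assms obtain e where e: "e \<in> edges (FR_product A B)" "x \<in> e" "y \<in> e" and ne: "x \<noteq> y"
    by (auto simp: orthogonal_in_def)
  from e(1) show ?thesis
  proof (cases rule: edges_FR_productE)
    case (1 eA f)
    then have mem: "fst x \<in> eA" "fst y \<in> eA" "snd x \<in> f (fst x)" "snd y \<in> f (fst y)"
      using e(2,3) by auto
    show ?thesis
    proof (cases "fst x = fst y")
      case True
      then have "snd x \<noteq> snd y" using ne by (simp add: prod_eq_iff)
      moreover have "f (fst x) \<in> edges B" using 1(2) mem(1) by (rule Pi_mem)
      ultimately show ?thesis using mem True unfolding orthogonal_in_def by metis
    next
      case False
      then show ?thesis using 1(1) mem unfolding orthogonal_in_def by blast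
    qed
  next
    case (2 eB f)
    then have mem: "snd x \<in> eB" "snd y \<in> eB" "fst x \<in> f (snd x)" "fst y \<in> f (snd y)"
      using e(2,3) by auto
    show ?thesis
    proof (cases "snd x = snd y")
      case True
      then have "fst x \<noteq> fst y" using ne by (simp add: prod_eq_iff)
      moreover have "f (snd x) \<in> edges A" using 2(2) mem(1) by (rule Pi_mem)
      ultimately show ?thesis using mem True unfolding orthogonal_in_def by metis
    next
      case False
      then show ?thesis using 2(1) mem unfolding orthogonal_in_def by blast
    qed
  qed
qed

lemma orthogonal_in_relabelE:
  assumes "orthogonal_in (relabel g H) x y"
  obtains u v where "x = g u" "y = g v" "orthogonal_in H u v"
  using assms by (auto simp: orthogonal_in_def relabel_def)

lemma orthogonal_in_FR_power:
  "orthogonal_in (FR_power H n) us vs \<Longrightarrow> \<exists>(u, v)\<in>set (zip us vs). orthogonal_in H u v"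
proof (induction H n arbitrary: us vs rule: FR_power.induct)
  case (1 H)
  then show ?case by (auto simp: orthogonal_in_def)
next
  case (2 H)
  then show ?case by (auto elim!: orthogonal_in_relabelE)
next
  case (3 H n)
  from "3.prems" obtain x y where xy: "us = fst x # snd x" "vs = fst y # snd y"
    and "orthogonal_in (FR_product H (FR_power H (Suc n))) x y"
    by (auto elim!: orthogonal_in_relabelE simp: case_prod_beta)
  from orthogonal_in_FR_product[OF this(3)] show ?case
    using "3.IH" xy by fastforce
qed

text \<open>The inner edge may depend on the outer vertex, but its weight is always 1, so the inner
  sum disappears.\<close>

lemma edges_FR_product_sum:
  fixes p :: "'a \<Rightarrow> real" and q :: "'b \<Rightarrow> real"
  assumes "e \<in> edges (FR_product A B)"
    and A: "\<And>e. e \<in> edges A \<Longrightarrow> finite e \<and> sum p e = 1"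
    and B: "\<And>e. e \<in> edges B \<Longrightarrow> finite e \<and> sum q e = 1"
  shows "finite e \<and> (\<Sum>(a, b)\<in>e. p a * q b) = 1"
proof -
  from assms(1) show ?thesis
  proof (cases rule: edges_FR_productE)
    case (1 eA f)
    then have f: "finite (f a) \<and> sum q (f a) = 1" if "a \<in> eA" for a
      using B that by (auto simp: Pi_iff)
    have "(\<Sum>(a, b)\<in>e. p a * q b) = (\<Sum>a\<in>eA. \<Sum>b\<in>f a. p a * q b)"
      using 1 A f by (subst sum.Sigma) auto
    also have "\<dots> = (\<Sum>a\<in>eA. p a)"
      using f by (simp flip: sum_distrib_left)
    finally show ?thesis using 1 A f by auto
  next
    case (2 eB f)
    then have f: "finite (f b) \<and> sum p (f b) = 1" if "b \<in> eB" for b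
      using A that by (auto simp: Pi_iff)
    have "(\<Sum>(a, b)\<in>e. p a * q b) = (\<Sum>(b, a)\<in>Sigma eB f. p a * q b)"
      unfolding 2(3) by (subst sum.reindex) (auto simp: case_prod_beta)
    also have "\<dots> = (\<Sum>b\<in>eB. \<Sum>a\<in>f b. p a * q b)"
      using 2 B f by (subst sum.Sigma) auto
    also have "\<dots> = (\<Sum>b\<in>eB. q b)"
      using f by (simp flip: sum_distrib_right)
    finally show ?thesis using 2 B f by auto
  qed
qed

lemma edges_FR_power_sum:
  fixes p :: "'a \<Rightarrow> real"
  assumes "\<And>e. e \<in> edges H \<Longrightarrow> finite e \<and> sum p e = 1"
  shows "e \<in> edges (FR_power H n) \<Longrightarrow> finite e \<and> (\<Sum>vs\<in>e. prod_list (map p vs)) = 1"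
  using assms
proof (induction H n arbitrary: e rule: FR_power.induct)
  case (1 H)
  then show ?case by simp
next
  case (2 H)
  then obtain e' where e: "e = (\<lambda>v. [v]) ` e'" "e' \<in> edges H"
    by (auto simp: relabel_def)
  then show ?case using 2 by (simp add: sum.reindex inj_on_def)
next
  case (3 H n)
  then obtain e' where e: "e = (\<lambda>(v, vs). v # vs) ` e'"
      "e' \<in> edges (FR_product H (FR_power H (Suc n)))"
    by (auto simp: relabel_def)
  have "(\<Sum>vs\<in>e. prod_list (map p vs)) = (\<Sum>(v, vs)\<in>e'. p v * prod_list (map p vs))"
    unfolding e by (subst sum.reindex) (auto simp: inj_on_def case_prod_beta)
  with edges_FR_product_sum[OF e(2), of p "\<lambda>vs. prod_list (map p vs)"] e(1) 3
  show ?case by auto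
qed

lemma edges_FR_power_subset:
  assumes "edges H \<subseteq> Pow (verts H)"
  shows "edges (FR_power H n) \<subseteq> Pow (verts (FR_power H n))"
  using assms
proof (induction H n rule: FR_power.induct)
  case (1 H)
  then show ?case by simp
next
  case (2 H)
  then show ?case by (auto simp: relabel_def)
next
  case (3 H n)
  then have "edges (FR_product H (FR_power H (Suc n)))
      \<subseteq> Pow (verts (FR_product H (FR_power H (Suc n))))"
    by (fastforce simp: FR_product_def)
  then show ?case by (auto simp: relabel_def)
qed

lemma prod_list_unit_interval:
  fixes f :: "'a \<Rightarrow> real"
  assumes "\<And>x. x \<in> set xs \<Longrightarrow> f x \<in> {0..1}"
  shows "prod_list (map f xs) \<in> {0..1}"
  using assms by (induction xs) (auto simp: mult_le_one)

lemma model_power_in_prob_models: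
  assumes H: "contextuality_scenario H" and p: "p \<in> prob_models H"
  shows "model_power H p n \<in> prob_models (FR_power H n)"
proof -
  have fin: "finite e" if "e \<in> edges H" for e
    using H that by (auto simp: contextuality_scenario_def intro: finite_subset)
  have "model_power H p n vs \<in> {0..1}" if "vs \<in> verts (FR_power H n)" for vs
    using that p prod_list_unit_interval[of vs p]
    by (force simp: verts_FR_power model_power_def prob_models_def)
  moreover have "sum (model_power H p n) e = 1" if e: "e \<in> edges (FR_power H n)" for e
  proof -
    have "e \<subseteq> verts (FR_power H n)"
      using H e edges_FR_power_subset by (auto simp: contextuality_scenario_def)
    then have "sum (model_power H p n) e = (\<Sum>vs\<in>e. prod_list (map p vs))"
      by (intro sum.cong) (auto simp: verts_FR_power model_power_def)
    also have "\<dots> = 1"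
      using edges_FR_power_sum[of H p] e fin p by (auto simp: prob_models_def)
    finally show ?thesis .
  qed
  ultimately show ?thesis
    by (auto simp: prob_models_def PiE_iff verts_FR_power model_power_def)
qed

text \<open>A consequence of independence in \<open>NO (FR_power H n)\<close> that refers to
  \<open>H\<close> alone; the rank bound and the Lovasz bound are both proved for all such
  families.\<close>

definition orthogonal_lists :: "'a hypergraph \<Rightarrow> nat \<Rightarrow> 'a list set \<Rightarrow> bool" where
  "orthogonal_lists H n I \<longleftrightarrow> I \<subseteq> {vs. set vs \<subseteq> verts H \<and> length vs = n} \<and>
     (\<forall>us\<in>I. \<forall>vs\<in>I. us \<noteq> vs \<longrightarrow> (\<exists>(u, v)\<in>set (zip us vs). orthogonal_in H u v))"

lemma CE_infI:
  assumes H: "contextuality_scenario H" and p: "p \<in> prob_models H"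
    and le: "\<And>n I. orthogonal_lists H n I \<Longrightarrow> (\<Sum>vs\<in>I. prod_list (map p vs)) \<le> 1"
  shows "p \<in> CE_inf H"
proof -
  have "(\<Sum>vs\<in>I. model_power H p n vs) \<le> 1"
    if "independent_vertices (NO (FR_power H n)) I" for n I
  proof -
    have sub: "I \<subseteq> {vs. set vs \<subseteq> verts H \<and> length vs = n}"
      using that by (simp add: independent_vertices_def NO_def verts_FR_power)
    have "orthogonal_in (FR_power H n) us vs" if "us \<in> I" "vs \<in> I" "us \<noteq> vs" for us vs
      using that \<open>independent_vertices _ _\<close>
      by (simp add: independent_vertices_def NO_def) blast
    then have "orthogonal_lists H n I"
      using sub orthogonal_in_FR_power unfolding orthogonal_lists_def by blast
    moreover have "(\<Sum>vs\<in>I. model_power H p n vs) = (\<Sum>vs\<in>I. prod_list (map p vs))"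
      using sub by (intro sum.cong) (auto simp: model_power_def)
    ultimately show ?thesis using le by simp
  qed
  then show ?thesis
    using p model_power_in_prob_models[OF H p] by (auto simp: CE_inf_def CE_def CE1_def)
qed

section \<open>Tensor powers of vectors\<close>

text \<open>The lists \<open>ks\<close> index the coordinates of a tensor power, so this is
  multiplicativity of inner products. The two label types allow a family of vectors on one side and
  a single fixed vector on the other.\<close>

lemma sum_lists_tensor:
  fixes f :: "'a \<Rightarrow> 'k \<Rightarrow> real" and g :: "'b \<Rightarrow> 'k \<Rightarrow> real"
  assumes "length us = n" "length vs = n"
  shows "(\<Sum>ks | set ks \<subseteq> D \<and> length ks = n. prod_list (map2 f us ks) * prod_list (map2 g vs ks))
    = prod_list (map2 (\<lambda>u v. \<Sum>k\<in>D. f u k * g v k) us vs)"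
  using assms
proof (induction n arbitrary: us vs)
  case 0
  then show ?case by (simp add: conj_commute cong: conj_cong)
next
  case (Suc n)
  then obtain u us' v vs' where uv: "us = u # us'" "vs = v # vs'"
    by (auto simp: length_Suc_conv)
  let ?L = "{ks. set ks \<subseteq> D \<and> length ks = n}"
  have "(\<Sum>ks | set ks \<subseteq> D \<and> length ks = Suc n. prod_list (map2 f us ks) * prod_list (map2 g vs ks))
      = (\<Sum>(ks, k)\<in>?L \<times> D. (f u k * prod_list (map2 f us' ks)) * (g v k * prod_list (map2 g vs' ks)))"
    unfolding lists_length_Suc_eq uv
    by (subst sum.reindex) (auto simp: inj_on_def case_prod_beta)
  also have "\<dots> = (\<Sum>(ks, k)\<in>?L \<times> D.
      (prod_list (map2 f us' ks) * prod_list (map2 g vs' ks)) * (f u k * g v k))"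
    by (simp add: mult_ac)
  also have "\<dots> = (\<Sum>ks\<in>?L. prod_list (map2 f us' ks) * prod_list (map2 g vs' ks))
      * (\<Sum>k\<in>D. f u k * g v k)"
    by (simp add: sum_product sum.cartesian_product)
  also have "(\<Sum>ks\<in>?L. prod_list (map2 f us' ks) * prod_list (map2 g vs' ks))
      = prod_list (map2 (\<lambda>u v. \<Sum>k\<in>D. f u k * g v k) us' vs')"
    using Suc uv by simp
  finally show ?case by (simp add: uv mult.commute)
qed

text \<open>The matrix of pairings of \<open>X\<close> with \<open>Y\<close> is diagonal and
  nonsingular, so its rank \<open>card S\<close> is at most \<open>card T\<close>. The induction is
  Gaussian elimination, removing one coordinate and at most one vector at a time.\<close>

lemma biorthogonal_card_le:
  fixes X Y :: "'s \<Rightarrow> 't \<Rightarrow> real"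
  assumes "finite T" "finite S"
    and "\<And>s. s \<in> S \<Longrightarrow> (\<Sum>t\<in>T. X s t * Y s t) \<noteq> 0"
    and "\<And>s s'. s \<in> S \<Longrightarrow> s' \<in> S \<Longrightarrow> s \<noteq> s' \<Longrightarrow> (\<Sum>t\<in>T. X s t * Y s' t) = 0"
  shows "card S \<le> card T"
  using assms
proof (induction T arbitrary: S X rule: finite_induct)
  case empty
  then have "S = {}" by fastforce
  then show ?case by simp
next
  case (insert t T)
  show ?case
  proof (cases "\<exists>s\<in>S. X s t \<noteq> 0")
    case False
    then have "(\<Sum>t\<in>insert t T. X s t * Y s' t) = (\<Sum>t\<in>T. X s t * Y s' t)" if "s \<in> S" for s s'
      using that insert.hyps by simp
    then have "card S \<le> card T"
      using insert.prems by (intro insert.IH[of S X]) auto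
    then show ?thesis using insert.hyps by simp
  next
    case True
    then obtain s0 where s0: "s0 \<in> S" "X s0 t \<noteq> 0" by blast
    \<comment> \<open>The pivot \<open>X s0\<close> clears coordinate \<open>t\<close>; pairings
      with the remaining \<open>Y s'\<close> do not change, since \<open>X s0\<close> is orthogonal
      to them.\<close>
    define X' where "X' s t' = X s t' - X s t / X s0 t * X s0 t'" for s t'
    have X': "(\<Sum>t\<in>T. X' s t * Y s' t) = (\<Sum>t\<in>insert t T. X s t * Y s' t)"
      if "s \<in> S - {s0}" "s' \<in> S - {s0}" for s s'
    proof -
      have "(\<Sum>t\<in>T. X' s t * Y s' t) = (\<Sum>t\<in>insert t T. X' s t * Y s' t)"
        using insert.hyps s0 by (simp add: X'_def)
      also have "\<dots> = (\<Sum>t\<in>insert t T. X s t * Y s' t)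
          - X s t / X s0 t * (\<Sum>t\<in>insert t T. X s0 t * Y s' t)"
        by (simp add: X'_def sum_subtractf sum_distrib_left left_diff_distrib mult.assoc del: sum.insert)
      also have "(\<Sum>t\<in>insert t T. X s0 t * Y s' t) = 0"
        using that s0 insert.prems by blast
      finally show ?thesis by simp
    qed
    have "card (S - {s0}) \<le> card T"
    proof (rule insert.IH[of "S - {s0}" X'])
      show "finite (S - {s0})" using insert.prems by simp
      show "(\<Sum>t\<in>T. X' s t * Y s t) \<noteq> 0" if "s \<in> S - {s0}" for s
        using X'[OF that that] insert.prems(2) that by auto
      show "(\<Sum>t\<in>T. X' s t * Y s' t) = 0" if "s \<in> S - {s0}" "s' \<in> S - {s0}" "s \<noteq> s'" for s s'
        using X'[OF that(1,2)] insert.prems(3) that by auto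
    qed
    then show ?thesis using insert.hyps insert.prems s0 by (simp add: card_Diff_singleton)
  qed
qed

section \<open>Haemers' rank bound for constant models\<close>

lemma finite_orthogonal_lists:
  "contextuality_scenario H \<Longrightarrow> orthogonal_lists H n I \<Longrightarrow> finite I"
  unfolding orthogonal_lists_def contextuality_scenario_def
  by (elim conjE) (rule finite_subset[OF _ finite_lists_length_eq])

lemma prod_list_map2_eq_0:
  fixes B :: "'a \<Rightarrow> 'b \<Rightarrow> real"
  assumes "\<exists>(u, v)\<in>set (zip us vs). B u v = 0"
  shows "prod_list (map2 B us vs) = 0"
  using assms by (force simp: prod_list_zero_iff)

lemma map2_same: "map2 f xs xs = map (\<lambda>x. f x x) xs"
  by (induction xs) auto

text \<open>Tensor powers of \<open>x\<close> and \<open>y\<close> are biorthogonal on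
  \<open>I\<close>, so \<open>I\<close> has at most \<open>card D ^ n\<close> lists, each of weight
  \<open>(1 / card D) ^ n\<close>. Keeping \<open>x\<close> and \<open>y\<close> separate admits
  indefinite bilinear forms.\<close>

lemma constant_model_in_CE_inf:
  fixes x y :: "'a \<Rightarrow> 'k \<Rightarrow> real"
  assumes H: "contextuality_scenario H" and D: "finite D"
    and p: "p \<in> prob_models H" "\<And>v. v \<in> verts H \<Longrightarrow> p v = 1 / card D"
    and nz: "\<And>v. v \<in> verts H \<Longrightarrow> (\<Sum>k\<in>D. x v k * y v k) \<noteq> 0"
    and z: "\<And>u v. orthogonal_in H u v \<Longrightarrow> (\<Sum>k\<in>D. x u k * y v k) = 0"
  shows "p \<in> CE_inf H"
proof (rule CE_infI[OF H p(1)])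
  fix n I assume I: "orthogonal_lists H n I"
  then have len: "length vs = n" "set vs \<subseteq> verts H" if "vs \<in> I" for vs
    using that by (auto simp: orthogonal_lists_def)
  let ?L = "{ks. set ks \<subseteq> D \<and> length ks = n}"
  have "card I \<le> card ?L"
  proof (rule biorthogonal_card_le[where X = "\<lambda>vs ks. prod_list (map2 x vs ks)"
        and Y = "\<lambda>vs ks. prod_list (map2 y vs ks)"])
    show "finite ?L" using D by (rule finite_lists_length_eq)
    show "finite I" using finite_orthogonal_lists H I by blast
    show "(\<Sum>ks\<in>?L. prod_list (map2 x vs ks) * prod_list (map2 y vs ks)) \<noteq> 0" if "vs \<in> I" for vs
      using len[OF that] nz by (subst sum_lists_tensor) (auto simp: map2_same prod_list_zero_iff)
    show "(\<Sum>ks\<in>?L. prod_list (map2 x us ks) * prod_list (map2 y vs ks)) = 0"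
      if "us \<in> I" "vs \<in> I" "us \<noteq> vs" for us vs
    proof -
      have "\<exists>(u, v)\<in>set (zip us vs). (\<Sum>k\<in>D. x u k * y v k) = 0"
        using I that z unfolding orthogonal_lists_def by fast
      then show ?thesis
        using len that by (subst sum_lists_tensor) (auto intro!: prod_list_map2_eq_0)
    qed
  qed
  then have "card I \<le> card D ^ n" using D by (simp add: card_lists_length_eq)
  then have card: "real (card I) \<le> real (card D) ^ n"
    by (metis of_nat_le_iff of_nat_power)
  have "prod_list (map p vs) = (1 / card D) ^ n" if "vs \<in> I" for vs
  proof -
    have "map p vs = replicate n (1 / card D)"
      using len[OF that] p(2) by (intro replicate_eqI) auto
    then show ?thesis by simp
  qed
  then have "(\<Sum>vs\<in>I. prod_list (map p vs)) = card I * (1 / card D) ^ n" by simp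
  also have "\<dots> = card I / card D ^ n" by (simp add: power_one_over)
  also have "\<dots> \<le> 1" using card by (intro divide_le_eq_1[THEN iffD2]) (auto simp: not_le)
  finally show "(\<Sum>vs\<in>I. prod_list (map p vs)) \<le> 1" .
qed

section \<open>Gram representations\<close>

text \<open>Cholesky decomposition: each step splits off the first column and passes to the Schur complement.\<close>

lemma gram_representation:
  fixes N :: "'i \<Rightarrow> 'i \<Rightarrow> real"
  assumes "finite J"
    and "\<And>i j. i \<in> J \<Longrightarrow> j \<in> J \<Longrightarrow> N i j = N j i"
    and "\<And>x. (\<Sum>i\<in>J. \<Sum>j\<in>J. x i * N i j * x j) \<ge> 0"
  shows "\<exists>m::nat. \<exists>a. \<forall>i\<in>J. \<forall>j\<in>J. N i j = (\<Sum>k<m. a i k * a j k)"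
  using assms
proof (induction J arbitrary: N rule: finite_induct)
  case empty
  then show ?case by simp
next
  case (insert i J)
  note sym = insert.prems(1)
  have split: "(\<Sum>j\<in>insert i J. \<Sum>k\<in>insert i J. x j * N j k * x k)
      = N i i * (x i)\<^sup>2 + 2 * x i * (\<Sum>j\<in>J. N i j * x j) + (\<Sum>j\<in>J. \<Sum>k\<in>J. x j * N j k * x k)" for x
  proof -
    have "(\<Sum>j\<in>J. x j * N j i * x i) = x i * (\<Sum>j\<in>J. N i j * x j)"
      unfolding sum_distrib_left using sym by (intro sum.cong) (auto simp: mult_ac)
    moreover have "(\<Sum>j\<in>J. x i * N i j * x j) = x i * (\<Sum>j\<in>J. N i j * x j)"
      by (simp add: sum_distrib_left mult_ac)
    ultimately show ?thesis
      using insert.hyps by (simp add: sum.distrib power2_eq_square algebra_simps)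
  qed
  have form: "0 \<le> N i i * t\<^sup>2 + 2 * t * (\<Sum>j\<in>J. N i j * x j) + (\<Sum>j\<in>J. \<Sum>k\<in>J. x j * N j k * x k)" for t x
  proof -
    have "(\<Sum>j\<in>J. N i j * (x(i := t)) j) = (\<Sum>j\<in>J. N i j * x j)"
      using insert.hyps by (intro sum.cong) auto
    moreover have "(\<Sum>j\<in>J. \<Sum>k\<in>J. (x(i := t)) j * N j k * (x(i := t)) k)
        = (\<Sum>j\<in>J. \<Sum>k\<in>J. x j * N j k * x k)"
      using insert.hyps by (intro sum.cong) auto
    ultimately show ?thesis
      using insert.prems(2)[of "x(i := t)"] unfolding split by simp
  qed
  have Nii: "N i i \<ge> 0" using form[of 1 "\<lambda>_. 0"] by simp
  \<comment> \<open>Along \<open>t\<close> times unit vector \<open>i\<close> plus unit vector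
    \<open>j\<close> the form is affine in \<open>t\<close>, so nonnegativity forces slope
    0.\<close>
  have col0: "N i j = 0" if "N i i = 0" "j \<in> J" for j
  proof (rule ccontr)
    assume nz: "N i j \<noteq> 0"
    have 1: "(\<Sum>k\<in>J. N i k * of_bool (k = j)) = N i j"
      using insert.hyps that by (simp add: of_bool_def if_distrib[of "(*) _"] sum.delta cong: if_cong)
    have "0 \<le> 2 * t * N i j + N j j" for t
      using form[of t "\<lambda>k. of_bool (k = j)"] that insert.hyps
      unfolding 1 by (simp add: of_bool_def if_distrib[of "(*) _"] if_distrib[of "\<lambda>z. z * _"] sum.delta cong: if_cong)
    \<comment> \<open>This \<open>t\<close> would give the form the value -1.\<close>
    from this[of "- (N j j + 1) / (2 * N i j)"] nz show False by (simp add: field_simps)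
  qed
  \<comment> \<open>If \<open>N i i = 0\<close>, the quotient is 0 by convention and
    \<open>N'\<close> equals \<open>N\<close>.\<close>
  define N' where "N' j k = N j k - N i j * N i k / N i i" for j k
  have "\<exists>m::nat. \<exists>a. \<forall>j\<in>J. \<forall>k\<in>J. N' j k = (\<Sum>l<m. a j l * a k l)"
  proof (rule insert.IH)
    show "N' j k = N' k j" if "j \<in> J" "k \<in> J" for j k
      using sym that by (simp add: N'_def)
    show "0 \<le> (\<Sum>j\<in>J. \<Sum>k\<in>J. x j * N' j k * x k)" for x
    proof -
      define s where "s = (\<Sum>j\<in>J. N i j * x j)"
      have "(\<Sum>j\<in>J. \<Sum>k\<in>J. x j * N' j k * x k)
          = (\<Sum>j\<in>J. \<Sum>k\<in>J. x j * N j k * x k) - (\<Sum>j\<in>J. \<Sum>k\<in>J. (N i j * x j) * (N i k * x k) / N i i)"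
        by (simp add: N'_def sum_subtractf algebra_simps)
      also have "(\<Sum>j\<in>J. \<Sum>k\<in>J. (N i j * x j) * (N i k * x k) / N i i) = s\<^sup>2 / N i i"
        by (simp add: s_def power2_eq_square sum_product flip: sum_divide_distrib)
      finally have eq: "(\<Sum>j\<in>J. \<Sum>k\<in>J. x j * N' j k * x k)
          = (\<Sum>j\<in>J. \<Sum>k\<in>J. x j * N j k * x k) - s\<^sup>2 / N i i" .
      \<comment> \<open>For \<open>N i i > 0\<close> the chosen \<open>t\<close> minimises the
        quadratic in \<open>form\<close>, and the minimum is the Schur complement form.\<close>
      show ?thesis
        using form[of "- s / N i i" x] unfolding eq s_def[symmetric]
        by (cases "N i i = 0") (auto simp: power2_eq_square field_simps)
    qed
  qed
  then obtain m :: nat and a where a: "\<And>j k. j \<in> J \<Longrightarrow> k \<in> J \<Longrightarrow> N' j k = (\<Sum>l<m. a j l * a k l)"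
    by blast
  \<comment> \<open>The scaled column of \<open>i\<close> becomes the new coordinate
    \<open>m\<close>; the vector of \<open>i\<close> is zero in all the old coordinates.\<close>
  define b where "b j l = (if l = m then N i j / sqrt (N i i) else if j = i then 0 else a j l)" for j l
  have b: "(\<Sum>l<Suc m. b j l * b k l)
      = (if j = i \<or> k = i then 0 else (\<Sum>l<m. a j l * a k l)) + N i j * N i k / N i i" for j k
    using Nii by (auto simp: b_def)
  have "N j k = (\<Sum>l<Suc m. b j l * b k l)" if "j \<in> insert i J" "k \<in> insert i J" for j k
    unfolding b using that insert.hyps sym[OF that] col0 a[of j k]
    by (cases "N i i = 0") (auto simp: N'_def)
  then show ?case by blast
qed

text \<open>On real test vectors a Hermitian form sees only the real parts of the entries, so
  \<open>Re M\<close> is positive semidefinite and has real Gram vectors. The vector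
  \<open>c\<close> belongs to the index \<open>None\<close>.\<close>

lemma Q1_gram:
  assumes H: "contextuality_scenario H" and p: "p \<in> Q1 H"
  obtains m :: nat and c :: "nat \<Rightarrow> real" and a :: "'a \<Rightarrow> nat \<Rightarrow> real" where
    "(\<Sum>k<m. c k * c k) = 1"
    "\<And>v. v \<in> verts H \<Longrightarrow> (\<Sum>k<m. a v k * c k) = p v"
    "\<And>v. v \<in> verts H \<Longrightarrow> (\<Sum>k<m. a v k * a v k) = p v"
    "\<And>u v. orthogonal_in H u v \<Longrightarrow> (\<Sum>k<m. a u k * a v k) = 0"
proof -
  let ?J = "insert None (Some ` verts H)"
  obtain M :: "'a option \<Rightarrow> 'a option \<Rightarrow> complex" where
    psd: "pos_semidef_on ?J M" and M1: "M None None = 1"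
    and Me: "\<And>e w. e \<in> edges H \<Longrightarrow> w \<in> ?J \<Longrightarrow> (\<Sum>x\<in>e. M (Some x) w) = M None w"
    and Mo: "\<And>u v. u \<in> verts H \<Longrightarrow> v \<in> verts H \<Longrightarrow> orthogonal_in H u v \<Longrightarrow> M (Some u) (Some v) = 0"
    and Mp: "\<And>v. v \<in> verts H \<Longrightarrow> complex_of_real (p v) = M (Some v) None"
    using p unfolding Q1_def by blast
  have V: "edges H \<subseteq> Pow (verts H)" "\<Union>(edges H) = verts H" and fin: "finite ?J"
    using H by (auto simp: contextuality_scenario_def)
  define N where "N i j = Re (M i j)" for i j
  have herm: "M j i = cnj (M i j)" if "i \<in> ?J" "j \<in> ?J" for i j
    using psd that unfolding pos_semidef_on_def by blast
  have "\<exists>m::nat. \<exists>a. \<forall>i\<in>?J. \<forall>j\<in>?J. N i j = (\<Sum>k<m. a i k * a j k)"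
  proof (rule gram_representation[OF fin])
    show "N i j = N j i" if "i \<in> ?J" "j \<in> ?J" for i j
      using herm[OF that] by (simp add: N_def)
    show "0 \<le> (\<Sum>i\<in>?J. \<Sum>j\<in>?J. x i * N i j * x j)" for x
    proof -
      have "(\<Sum>i\<in>?J. \<Sum>j\<in>?J. cnj (complex_of_real (x i)) * M i j * complex_of_real (x j)) \<in> \<real>\<^sub>\<ge>\<^sub>0"
        using psd[unfolded pos_semidef_on_def, THEN conjunct2, rule_format, of "\<lambda>i. complex_of_real (x i)"] .
      then have "0 \<le> Re (\<Sum>i\<in>?J. \<Sum>j\<in>?J. cnj (complex_of_real (x i)) * M i j * complex_of_real (x j))"
        by (simp only: complex_nonneg_Reals_iff)
      also have "\<dots> = (\<Sum>i\<in>?J. \<Sum>j\<in>?J. x i * N i j * x j)"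
        by (simp add: N_def)
      finally show ?thesis .
    qed
  qed
  then obtain m :: nat and a where a: "\<And>i j. i \<in> ?J \<Longrightarrow> j \<in> ?J \<Longrightarrow> N i j = (\<Sum>k<m. a i k * a j k)"
    by blast
  \<comment> \<open>Summing column \<open>v\<close> over an edge through \<open>v\<close> leaves
    only the diagonal entry, as the other vertices of the edge are orthogonal to
    \<open>v\<close>.\<close>
  have Mvv: "M (Some v) (Some v) = p v" if v: "v \<in> verts H" for v
  proof -
    obtain e where e: "e \<in> edges H" "v \<in> e" using V v by blast
    have sub: "e \<subseteq> verts H" and fe: "finite e"
      using e V H by (auto simp: contextuality_scenario_def intro: finite_subset)
    have "M None (Some v) = (\<Sum>x\<in>e. M (Some x) (Some v))" using Me e v by auto
    also have "\<dots> = (\<Sum>x\<in>e. if x = v then M (Some v) (Some v) else 0)"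
      using e sub v by (intro sum.cong) (auto intro!: Mo simp: orthogonal_in_def)
    also have "\<dots> = M (Some v) (Some v)" using e fe by simp
    finally show ?thesis
      using herm[of "Some v" None] v Mp[OF v, symmetric] by simp
  qed
  have orth_verts: "u \<in> verts H \<and> v \<in> verts H" if "orthogonal_in H u v" for u v
    using that V by (auto simp: orthogonal_in_def)
  show thesis
  proof (rule that[where m = m and c = "a None" and a = "\<lambda>v. a (Some v)"])
    show "(\<Sum>k<m. a None k * a None k) = 1"
      by (subst a[symmetric]) (auto simp: N_def M1)
    show "(\<Sum>k<m. a (Some v) k * a None k) = p v" if "v \<in> verts H" for v
      using that by (subst a[symmetric]) (auto simp: N_def Mp[symmetric])
    show "(\<Sum>k<m. a (Some v) k * a (Some v) k) = p v" if "v \<in> verts H" for v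
      using that by (subst a[symmetric]) (auto simp: N_def Mvv)
    show "(\<Sum>k<m. a (Some u) k * a (Some v) k) = 0" if "orthogonal_in H u v" for u v
      using orth_verts[OF that] Mo that by (subst a[symmetric]) (auto simp: N_def)
  qed
qed

text \<open>This is the nonnegativity of the squared length of \<open>r c - w\<close>, where
  \<open>w\<close> is the sum of the vectors \<open>b s\<close>. The scale \<open>r\<close> stays
  free: 1 yields the Lovasz bound, 3 the final contradiction.\<close>

lemma sum_inner_ge:
  fixes b :: "'s \<Rightarrow> 't \<Rightarrow> real"
  assumes "(\<Sum>t\<in>T. c t * c t) = 1"
    and "\<And>s. s \<in> I \<Longrightarrow> (\<Sum>t\<in>T. b s t * c t) = q s"
  shows "2 * r * (\<Sum>s\<in>I. q s) - r\<^sup>2 \<le> (\<Sum>s\<in>I. \<Sum>s'\<in>I. \<Sum>t\<in>T. b s t * b s' t)"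
proof -
  let ?w = "\<lambda>t. \<Sum>s\<in>I. b s t"
  have wc: "(\<Sum>t\<in>T. ?w t * c t) = (\<Sum>s\<in>I. q s)"
    unfolding sum_distrib_right by (subst sum.swap) (simp add: assms(2))
  have "(\<Sum>t\<in>T. ?w t * ?w t) = (\<Sum>t\<in>T. \<Sum>s\<in>I. \<Sum>s'\<in>I. b s t * b s' t)"
    by (simp add: sum_product)
  also have "\<dots> = (\<Sum>s\<in>I. \<Sum>s'\<in>I. \<Sum>t\<in>T. b s t * b s' t)"
    by (subst sum.swap, intro sum.cong refl, subst sum.swap, rule refl)
  finally have ww: "(\<Sum>t\<in>T. ?w t * ?w t) = (\<Sum>s\<in>I. \<Sum>s'\<in>I. \<Sum>t\<in>T. b s t * b s' t)" .
  have "(\<Sum>t\<in>T. (r * c t - w t)\<^sup>2)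
      = r\<^sup>2 * (\<Sum>t\<in>T. c t * c t) - 2 * r * (\<Sum>t\<in>T. w t * c t) + (\<Sum>t\<in>T. w t * w t)" for w
    unfolding sum_distrib_left sum_subtractf[symmetric] sum.distrib[symmetric]
    by (intro sum.cong refl) (simp add: power2_eq_square algebra_simps)
  note square = this[of ?w]
  have "0 \<le> (\<Sum>t\<in>T. (r * c t - ?w t)\<^sup>2)" by (rule sum_nonneg) simp
  then show ?thesis unfolding square wc ww assms(1) by simp
qed

text \<open>Orthogonality reduces the double sum to its diagonal, the total \<open>Q\<close> of
  \<open>q\<close>, and \<open>r = 1\<close> gives \<open>2 Q - 1 <= Q\<close>.\<close>

lemma sum_orthogonal_le_1:
  fixes b :: "'s \<Rightarrow> 't \<Rightarrow> real"
  assumes "finite I" "(\<Sum>t\<in>T. c t * c t) = 1"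
    and "\<And>s. s \<in> I \<Longrightarrow> (\<Sum>t\<in>T. b s t * c t) = q s"
    and "\<And>s. s \<in> I \<Longrightarrow> (\<Sum>t\<in>T. b s t * b s t) = q s"
    and "\<And>s s'. s \<in> I \<Longrightarrow> s' \<in> I \<Longrightarrow> s \<noteq> s' \<Longrightarrow> (\<Sum>t\<in>T. b s t * b s' t) = 0"
  shows "(\<Sum>s\<in>I. q s) \<le> 1"
proof -
  have "(\<Sum>s\<in>I. \<Sum>s'\<in>I. \<Sum>t\<in>T. b s t * b s' t) = (\<Sum>s\<in>I. \<Sum>s'\<in>I. if s' = s then q s else 0)"
    using assms(4,5) by (intro sum.cong) auto
  also have "\<dots> = (\<Sum>s\<in>I. q s)" using assms(1) by simp
  finally show ?thesis using sum_inner_ge[where b = b and I = I and r = 1 and q = q and c = c and T = T] assms(2,3) by simp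
qed

section \<open>Inclusion of \<open>Q1\<close> in \<open>CE_inf\<close>\<close>

lemma map2_replicate: "length xs = n \<Longrightarrow> map2 f xs (replicate n y) = map (\<lambda>x. f x y) xs"
  by (induction xs arbitrary: n) auto

lemma Q1_subset_prob_models:
  assumes "contextuality_scenario H"
  shows "Q1 H \<subseteq> prob_models H"
proof
  fix p assume p: "p \<in> Q1 H"
  then obtain M :: "'a option \<Rightarrow> 'a option \<Rightarrow> complex" where M1: "M None None = 1"
    and Me: "\<And>e. e \<in> edges H \<Longrightarrow> (\<Sum>x\<in>e. M (Some x) None) = M None None"
    and Mp: "\<And>v. v \<in> verts H \<Longrightarrow> complex_of_real (p v) = M (Some v) None"
    unfolding Q1_def by blast
  have "sum p e = 1" if e: "e \<in> edges H" for e
  proof -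
    have "e \<subseteq> verts H" using e assms by (auto simp: contextuality_scenario_def)
    then have "complex_of_real (sum p e) = (\<Sum>x\<in>e. M (Some x) None)"
      using Mp by (auto intro!: sum.cong simp del: of_real_sum simp: of_real_sum[of p e])
    then have "complex_of_real (sum p e) = complex_of_real 1" using Me[OF e] M1 by simp
    then show ?thesis by (simp only: of_real_eq_iff)
  qed
  then show "p \<in> prob_models H" using p by (auto simp: prob_models_def Q1_def)
qed

lemma Q1_subset_CE_inf:
  assumes H: "contextuality_scenario H"
  shows "Q1 H \<subseteq> CE_inf H"
proof
  fix p assume p: "p \<in> Q1 H"
  obtain m :: nat and c :: "nat \<Rightarrow> real" and a :: "'a \<Rightarrow> nat \<Rightarrow> real" where
    cc: "(\<Sum>k<m. c k * c k) = 1"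
    and ac: "\<And>v. v \<in> verts H \<Longrightarrow> (\<Sum>k<m. a v k * c k) = p v"
    and aa: "\<And>v. v \<in> verts H \<Longrightarrow> (\<Sum>k<m. a v k * a v k) = p v"
    and ao: "\<And>u v. orthogonal_in H u v \<Longrightarrow> (\<Sum>k<m. a u k * a v k) = 0"
    by (rule Q1_gram[OF H p]) (rule that, assumption+)
  show "p \<in> CE_inf H"
  proof (rule CE_infI[OF H])
    show "p \<in> prob_models H" using p Q1_subset_prob_models[OF H] by blast
    fix n I assume I: "orthogonal_lists H n I"
    then have len: "length vs = n" "set vs \<subseteq> verts H" if "vs \<in> I" for vs
      using that by (auto simp: orthogonal_lists_def)
    \<comment> \<open>Dummy labels present the tensor power of the single vector \<open>c\<close> as
      an instance of \<open>sum_lists_tensor\<close>.\<close>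
    let ?C = "replicate n ()"
    let ?L = "{ks. set ks \<subseteq> {..<m} \<and> length ks = n}"
    show "(\<Sum>vs\<in>I. prod_list (map p vs)) \<le> 1"
    proof (rule sum_orthogonal_le_1[where T = ?L and c = "\<lambda>ks. prod_list (map2 (\<lambda>_. c) ?C ks)"
          and b = "\<lambda>vs ks. prod_list (map2 a vs ks)"])
      show "finite I" using finite_orthogonal_lists H I by blast
      show "(\<Sum>ks\<in>?L. prod_list (map2 (\<lambda>_. c) ?C ks) * prod_list (map2 (\<lambda>_. c) ?C ks)) = 1"
        by (subst sum_lists_tensor) (auto simp: map2_same cc)
      show "(\<Sum>ks\<in>?L. prod_list (map2 a vs ks) * prod_list (map2 (\<lambda>_. c) ?C ks)) = prod_list (map p vs)"
        if "vs \<in> I" for vs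
      proof -
        have "map (\<lambda>v. \<Sum>k<m. a v k * c k) vs = map p vs" using len[OF that] ac by auto
        then show ?thesis using len[OF that] by (subst sum_lists_tensor) (simp_all add: map2_replicate del: map_eq_conv)
      qed
      show "(\<Sum>ks\<in>?L. prod_list (map2 a vs ks) * prod_list (map2 a vs ks)) = prod_list (map p vs)"
        if "vs \<in> I" for vs
      proof -
        have "map (\<lambda>v. \<Sum>k<m. a v k * a v k) vs = map p vs" using len[OF that] aa by auto
        then show ?thesis using len[OF that] by (subst sum_lists_tensor) (simp_all add: map2_same del: map_eq_conv)
      qed
      show "(\<Sum>ks\<in>?L. prod_list (map2 a us ks) * prod_list (map2 a vs ks)) = 0"
        if "us \<in> I" "vs \<in> I" "us \<noteq> vs" for us vs
      proof -
        have "\<exists>(u, v)\<in>set (zip us vs). (\<Sum>k<m. a u k * a v k) = 0"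
          using I that ao unfolding orthogonal_lists_def by fast
        then show ?thesis
          using len that by (subst sum_lists_tensor) (auto intro!: prod_list_map2_eq_0)
      qed
    qed
  qed
qed

section \<open>The 27 lines\<close>

text \<open>
  Classes \<open>d \<ell> - \<Sum> m\<^sub>i e\<^sub>i\<close> on the blow-up of the plane in six points are written
  \<open>[d, m\<^sub>1, \<dots>, m\<^sub>6]\<close>.  The first 27 are the lines (norm \<open>-1\<close>): the exceptional curves, the
  strict transforms of lines through two of the points and those of conics through five of them.
  The others, of norm \<open>1\<close>, each complete six pairwise skew lines to an orthogonal basis.
  The sixes are chosen such that they cover all pairs of skew lines.
\<close>

definition classes :: "int list list" where
  "classes =
    [[0, -1, 0, 0, 0, 0, 0], [0, 0, -1, 0, 0, 0, 0], [0, 0, 0, -1, 0, 0, 0],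
     [0, 0, 0, 0, -1, 0, 0], [0, 0, 0, 0, 0, -1, 0], [0, 0, 0, 0, 0, 0, -1],
     [1, 1, 1, 0, 0, 0, 0], [1, 1, 0, 1, 0, 0, 0], [1, 1, 0, 0, 1, 0, 0],
     [1, 1, 0, 0, 0, 1, 0], [1, 1, 0, 0, 0, 0, 1], [1, 0, 1, 1, 0, 0, 0],
     [1, 0, 1, 0, 1, 0, 0], [1, 0, 1, 0, 0, 1, 0], [1, 0, 1, 0, 0, 0, 1],
     [1, 0, 0, 1, 1, 0, 0], [1, 0, 0, 1, 0, 1, 0], [1, 0, 0, 1, 0, 0, 1],
     [1, 0, 0, 0, 1, 1, 0], [1, 0, 0, 0, 1, 0, 1], [1, 0, 0, 0, 0, 1, 1],
     [2, 0, 1, 1, 1, 1, 1], [2, 1, 0, 1, 1, 1, 1], [2, 1, 1, 0, 1, 1, 1],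
     [2, 1, 1, 1, 0, 1, 1], [2, 1, 1, 1, 1, 0, 1], [2, 1, 1, 1, 1, 1, 0],
     [2, 0, 0, 0, 1, 1, 1], [2, 0, 1, 1, 0, 0, 1], [2, 0, 1, 1, 0, 1, 0],
     [3, 0, 1, 1, 2, 1, 1], [2, 1, 0, 0, 0, 1, 1], [2, 1, 0, 1, 1, 0, 0],
     [3, 1, 0, 2, 1, 1, 1], [2, 1, 1, 0, 1, 0, 0], [3, 1, 2, 0, 1, 1, 1],
     [3, 2, 1, 1, 0, 1, 1], [3, 1, 1, 1, 1, 0, 2], [3, 1, 1, 1, 1, 2, 0],
     [4, 2, 2, 2, 1, 1, 1], [4, 2, 1, 1, 2, 2, 1], [4, 2, 1, 1, 2, 1, 2],
     [4, 1, 2, 2, 2, 1, 1], [4, 1, 2, 1, 1, 2, 2], [4, 1, 1, 2, 1, 2, 2]]"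

text \<open>Entries are positions in \<open>classes\<close>. Each row ends with the class of a line
  in the plane obtained by contracting the six skew lines before it.\<close>

definition bases :: "nat list list" where
  "bases =
    [[0, 1, 2, 18, 19, 20, 27], [0, 3, 4, 11, 14, 17, 28], [0, 3, 5, 11, 13, 16, 29],
     [0, 12, 15, 18, 19, 21, 30], [1, 2, 3, 9, 10, 20, 31], [1, 4, 5, 7, 8, 15, 32],
     [1, 7, 15, 16, 17, 22, 33], [2, 4, 5, 6, 8, 12, 34], [2, 6, 12, 13, 14, 23, 35],
     [3, 6, 7, 9, 10, 24, 36], [4, 10, 14, 17, 19, 25, 37], [5, 9, 13, 16, 18, 26, 38],
     [6, 7, 11, 24, 25, 26, 39], [8, 9, 18, 22, 23, 26, 40], [8, 10, 19, 22, 23, 25, 41],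
     [11, 12, 15, 21, 25, 26, 42], [13, 14, 20, 21, 23, 24, 43], [16, 17, 20, 21, 22, 24, 44]]"

fun intersection :: "int list \<Rightarrow> int list \<Rightarrow> int" where
  "intersection (x # xs) (y # ys) = x * y - sum_list (map2 (*) xs ys)"
| "intersection _ _ = 0"

definition lines_scenario :: "nat hypergraph" where
  "lines_scenario = \<lparr>verts = {..<45}, edges = set ` set bases\<rparr>"

section \<open>Intersection numbers of the classes\<close>

lemma length_classes: "length classes = 45"
  by (simp add: classes_def)

lemma length_class:
  assumes "v < 45"
  shows "length (classes ! v) = 7"
proof -
  have "list_all (\<lambda>c. length c = 7) classes" by (simp add: classes_def)
  then show ?thesis using assms by (simp add: list_all_length length_classes)
qed

text \<open>The sign sits in the second factor, which matches the separate families \<open>x\<close>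
  and \<open>y\<close> of \<open>constant_model_in_CE_inf\<close>.\<close>

lemma intersection_eq_sum:
  assumes "length x = 7" "length y = 7"
  shows "intersection x y = (\<Sum>k<7. x ! k * ((if k = 0 then 1 else - 1) * y ! k))"
  using assms by (auto simp: length_Suc_conv numeral_eq_Suc)

lemma bases_cover: "\<forall>v<45. \<exists>b\<in>set bases. v \<in> set b"
proof -
  have "list_all (\<lambda>v. list_ex (\<lambda>b. v \<in> set b) bases) [0..<45]" by code_simp
  then show ?thesis by (simp add: list_all_iff list_ex_iff)
qed

lemma bases_orthogonal:
  assumes "b \<in> set bases"
  shows "length b = 7" "distinct b" "set b \<subseteq> {..<45}"
    and "\<And>u v. u \<in> set b \<Longrightarrow> v \<in> set b \<Longrightarrow> u \<noteq> v \<Longrightarrow> intersection (classes ! u) (classes ! v) = 0"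
proof -
  have "list_all (\<lambda>b. length b = 7 \<and> distinct b \<and> list_all (\<lambda>v. v < 45) b \<and>
      list_all (\<lambda>u. list_all (\<lambda>v. u = v \<or> intersection (classes ! u) (classes ! v) = 0) b) b) bases"
    by code_simp
  then show "length b = 7" "distinct b" "set b \<subseteq> {..<45}"
    and "\<And>u v. u \<in> set b \<Longrightarrow> v \<in> set b \<Longrightarrow> u \<noteq> v \<Longrightarrow> intersection (classes ! u) (classes ! v) = 0"
    using assms by (auto simp: list_all_iff)
qed

lemma classes_norm:
  assumes "v < 45"
  shows "intersection (classes ! v) (classes ! v) \<noteq> 0"
proof -
  have "list_all (\<lambda>c. intersection c c \<noteq> 0) classes" by code_simp
  then show ?thesis using assms by (simp add: list_all_length length_classes)
qed

text \<open>Distinct lines either meet in one point or are skew; since the chosen sixes cover all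
  skew pairs, skewness becomes orthogonality in the scenario.\<close>

lemma lines_intersection:
  assumes "u < 27" "v < 27"
  shows "intersection (classes ! u) (classes ! v) = (if u = v then - 1 else 1)
    \<or> u \<noteq> v \<and> (\<exists>b\<in>set bases. u \<in> set b \<and> v \<in> set b)"
proof -
  have "list_all (\<lambda>u. list_all (\<lambda>v.
      intersection (classes ! u) (classes ! v) = (if u = v then - 1 else 1)
      \<or> u \<noteq> v \<and> list_ex (\<lambda>b. u \<in> set b \<and> v \<in> set b) bases) [0..<27]) [0..<27]"
    by code_simp
  then show ?thesis using assms by (simp add: list_all_iff list_ex_iff)
qed

text \<open>Every line has pairing 1 with the anticanonical class
  \<open>[3, 1, 1, 1, 1, 1, 1]\<close>.\<close>

lemma lines_degree:
  assumes "v < 27"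
  shows "(\<Sum>k=1..<7. classes ! v ! k) = 3 * classes ! v ! 0 - 1"
proof -
  have "list_all (\<lambda>c. sum_list (tl c) = 3 * hd c - 1) (take 27 classes)" by code_simp
  then have "sum_list (tl (classes ! v)) = 3 * hd (classes ! v) - 1"
    using assms by (simp add: list_all_length length_classes)
  then show ?thesis using length_class[of v] assms
    by (auto simp: length_Suc_conv numeral_eq_Suc)
qed

section \<open>The scenario and its uniform model\<close>

lemma lines_scenario: "contextuality_scenario lines_scenario"
  unfolding contextuality_scenario_def lines_scenario_def
  using bases_orthogonal(3) bases_cover by fastforce

lemma orthogonal_in_lines_scenario:
  "orthogonal_in lines_scenario u v \<longleftrightarrow> u \<noteq> v \<and> (\<exists>b\<in>set bases. u \<in> set b \<and> v \<in> set b)"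
  by (auto simp: orthogonal_in_def lines_scenario_def)

definition uniform_model :: "nat \<Rightarrow> real" where
  "uniform_model = (\<lambda>v\<in>{..<45}. 1 / 7)"

lemma uniform_model_in_prob_models: "uniform_model \<in> prob_models lines_scenario"
proof -
  have "sum uniform_model (set b) = 1" if "b \<in> set bases" for b
  proof -
    have "sum uniform_model (set b) = (\<Sum>v\<in>set b. 1 / 7)"
      using bases_orthogonal(3)[OF that] by (intro sum.cong) (auto simp: uniform_model_def)
    also have "\<dots> = 1"
      using bases_orthogonal(1,2)[OF that] by (simp add: distinct_card)
    finally show ?thesis .
  qed
  then show ?thesis by (auto simp: prob_models_def lines_scenario_def uniform_model_def)
qed

lemma uniform_model_in_CE_inf: "uniform_model \<in> CE_inf lines_scenario"
proof (rule constant_model_in_CE_inf[OF lines_scenario, where D = "{..<7::nat}"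
      and x = "\<lambda>v k. real_of_int (classes ! v ! k)"
      and y = "\<lambda>v k. real_of_int ((if k = 0 then 1 else - 1) * classes ! v ! k)"])
  have eq: "(\<Sum>k<7. real_of_int (classes ! u ! k) * real_of_int ((if k = 0 then 1 else - 1) * classes ! v ! k))
      = real_of_int (intersection (classes ! u) (classes ! v))" if "u < 45" "v < 45" for u v
    using that by (simp only: intersection_eq_sum length_class of_int_sum of_int_mult)
  show "(\<Sum>k<7. real_of_int (classes ! v ! k) * real_of_int ((if k = 0 then 1 else - 1) * classes ! v ! k)) \<noteq> 0"
    if "v \<in> verts lines_scenario" for v
  proof -
    have "v < 45" using that by (simp add: lines_scenario_def)
    then show ?thesis using classes_norm[of v] by (simp only: eq of_int_eq_0_iff not_False_eq_True)
  qed
  show "(\<Sum>k<7. real_of_int (classes ! u ! k) * real_of_int ((if k = 0 then 1 else - 1) * classes ! v ! k)) = 0"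
    if orth: "orthogonal_in lines_scenario u v" for u v
  proof -
    obtain b where b: "u \<noteq> v" "b \<in> set bases" "u \<in> set b" "v \<in> set b"
      using orth by (auto simp: orthogonal_in_lines_scenario)
    then have "u < 45" "v < 45" using bases_orthogonal(3) by auto
    then show ?thesis using bases_orthogonal(4)[OF b(2,3,4,1)] by (simp only: eq of_int_eq_0_iff)
  qed
qed (simp_all add: uniform_model_in_prob_models, simp add: uniform_model_def lines_scenario_def)

section \<open>The dual certificate against \<open>Q1\<close>\<close>

lemma sum_kernels_nonneg:
  fixes a :: "'s \<Rightarrow> 'k \<Rightarrow> real" and b :: "'s \<Rightarrow> 'l \<Rightarrow> real"
  shows "0 \<le> (\<Sum>u\<in>S. \<Sum>v\<in>S. (\<Sum>k\<in>K. a u k * a v k) * (\<Sum>l\<in>L. b u l * b v l))"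
proof -
  \<comment> \<open>The entrywise product of two Gram kernels is the Gram kernel of the tensor
    products \<open>a u k * b u l\<close>, so its total is a squared length.\<close>
  have "(\<Sum>u\<in>S. \<Sum>v\<in>S. (\<Sum>k\<in>K. a u k * a v k) * (\<Sum>l\<in>L. b u l * b v l))
      = (\<Sum>u\<in>S. \<Sum>v\<in>S. \<Sum>(k, l)\<in>K \<times> L. (a u k * b u l) * (a v k * b v l))"
    by (simp add: sum_product sum.cartesian_product mult_ac)
  also have "\<dots> = (\<Sum>u\<in>S. \<Sum>(k, l)\<in>K \<times> L. \<Sum>v\<in>S. (a u k * b u l) * (a v k * b v l))"
    by (subst sum.swap) (simp add: case_prod_beta)
  also have "\<dots> = (\<Sum>(k, l)\<in>K \<times> L. \<Sum>u\<in>S. \<Sum>v\<in>S. (a u k * b u l) * (a v k * b v l))"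
    by (subst sum.swap) (simp add: case_prod_beta)
  also have "\<dots> = (\<Sum>(k, l)\<in>K \<times> L. (\<Sum>u\<in>S. a u k * b u l)\<^sup>2)"
    by (simp add: power2_eq_square sum_product)
  also have "\<dots> \<ge> 0" by (intro sum_nonneg) (simp add: case_prod_beta)
  finally show ?thesis .
qed

text \<open>
  On lines, the Gram kernel of these coordinates is a multiple of the intersection form on the
  orthogonal complement of the anticanonical class, a negative definite \<open>E\<^sub>6\<close> lattice.
\<close>

definition root_coord :: "nat \<Rightarrow> nat \<Rightarrow> real" where
  "root_coord v k = (if k = 0 then sqrt 18 * (1 - classes ! v ! 0)
     else 6 * classes ! v ! k + (1 - 3 * classes ! v ! 0))"

text \<open>Subtracting a third of the anticanonical class from two lines leaves the form
  \<open><u,v> - 1/3\<close>, and the kernel is -36 times this. By \<open>lines_degree\<close> the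
  \<open>m_i\<close> have mean \<open>(3 d - 1) / 6\<close>; coordinates 1 to 6 are six times the
  deviations from it. The mean parts contribute \<open>54 (d - 1) (d' - 1)\<close> and the time part
  \<open>-36 (d - 1) (d' - 1)\<close>; their sum explains \<open>sqrt 18\<close>.\<close>

lemma lines_kernel:
  assumes "u < 27" "v < 27"
  shows "(\<Sum>k<7. root_coord u k * root_coord v k) = 12 * (1 - 3 * intersection (classes ! u) (classes ! v))"
proof -
  let ?u = "\<lambda>k. classes ! u ! k" and ?v = "\<lambda>k. classes ! v ! k"
  have split: "(\<Sum>k<7. h k) = h 0 + (\<Sum>k=1..<7. h k)" for h :: "nat \<Rightarrow> real"
    by (simp add: sum.atLeast_Suc_lessThan lessThan_atLeast0)
  have deg: "(\<Sum>k=1..<7. real_of_int (classes ! w ! k)) = 3 * classes ! w ! 0 - 1" if "w < 27" for w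
    using arg_cong[OF lines_degree[OF that], of real_of_int] by simp
  let ?s = "1 - 3 * real_of_int (?u 0)" and ?t = "1 - 3 * real_of_int (?v 0)"
  have expand: "(\<Sum>k=1..<7. (6 * f k + s) * (6 * g k + t))
      = 36 * (\<Sum>k=1..<7. f k * g k) + 6 * t * (\<Sum>k=1..<7. f k) + 6 * s * (\<Sum>k=1..<7. g k) + 6 * s * t"
    for f g :: "nat \<Rightarrow> real" and s t
  proof -
    have "(6 * f k + s) * (6 * g k + t) = 36 * (f k * g k) + 6 * t * f k + 6 * s * g k + s * t" for k
      by (simp add: algebra_simps)
    then show ?thesis by (simp add: sum.distrib flip: sum_distrib_left)
  qed
  have "(\<Sum>k=1..<7. root_coord u k * root_coord v k) = (\<Sum>k=1..<7. (6 * ?u k + ?s) * (6 * ?v k + ?t))"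
    by (intro sum.cong) (auto simp: root_coord_def)
  also have "\<dots> = 36 * (\<Sum>k=1..<7. real_of_int (?u k) * ?v k) + 6 * ?t * (\<Sum>k=1..<7. real_of_int (?u k))
      + 6 * ?s * (\<Sum>k=1..<7. real_of_int (?v k)) + 6 * ?s * ?t"
    using expand[of "\<lambda>k. real_of_int (?u k)" ?s "\<lambda>k. real_of_int (?v k)" ?t] by simp
  \<comment> \<open>By \<open>deg\<close> the two linear sums are \<open>- ?s\<close> and
    \<open>- ?t\<close>, so the last three terms add up to \<open>- 6 * ?s * ?t\<close>.\<close>
  finally have "(\<Sum>k=1..<7. root_coord u k * root_coord v k)
      = 36 * (\<Sum>k=1..<7. real_of_int (?u k * ?v k)) - 6 * ?s * ?t"
    unfolding deg[OF assms(1)] deg[OF assms(2)] by (simp add: algebra_simps)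
  moreover have "sqrt 18 * a * (sqrt 18 * b) = 18 * a * b" for a b :: real
  proof -
    have "sqrt 18 * a * (sqrt 18 * b) = (sqrt 18 * sqrt 18) * (a * b)" by (simp only: ac_simps)
    then show ?thesis by simp
  qed
  from this[of "1 - ?u 0" "1 - ?v 0"]
  have "root_coord u 0 * root_coord v 0 = 18 * (1 - ?u 0) * (1 - ?v 0)"
    by (simp only: root_coord_def simp_thms if_True of_int_mult of_int_numeral)
  ultimately have "(\<Sum>k<7. root_coord u k * root_coord v k)
      = 18 * (1 - ?u 0) * (1 - ?v 0) + 36 * (\<Sum>k=1..<7. real_of_int (?u k * ?v k)) - 6 * ?s * ?t"
    unfolding split by simp
  moreover have "real_of_int (intersection (classes ! u) (classes ! v))
      = ?u 0 * ?v 0 - (\<Sum>k=1..<7. real_of_int (?u k * ?v k))"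
    using assms(1,2) unfolding intersection_eq_sum[OF length_class length_class] of_int_sum split
    by (subst intersection_eq_sum) (auto simp: length_class split sum_negf)
  ultimately show ?thesis by (simp add: algebra_simps)
qed

text \<open>Let \<open>S\<close> be the sum of \<open>Z u v\<close> over all pairs of lines. The
  unit vector \<open>c\<close> forces \<open>S >= 99/7\<close>, the certificate
  \<open>S <= 81/7\<close>.\<close>

lemma uniform_model_notin_Q1: "uniform_model \<notin> Q1 lines_scenario"
proof
  assume "uniform_model \<in> Q1 lines_scenario"
  then obtain m :: nat and c :: "nat \<Rightarrow> real" and a :: "nat \<Rightarrow> nat \<Rightarrow> real" where
    cc: "(\<Sum>k<m. c k * c k) = 1"
    and ac: "\<And>v. v < 45 \<Longrightarrow> (\<Sum>k<m. a v k * c k) = 1 / 7"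
    and aa: "\<And>v. v < 45 \<Longrightarrow> (\<Sum>k<m. a v k * a v k) = 1 / 7"
    and ao: "\<And>u v. orthogonal_in lines_scenario u v \<Longrightarrow> (\<Sum>k<m. a u k * a v k) = 0"
    by (rule Q1_gram[OF lines_scenario]) (force simp: uniform_model_def lines_scenario_def)
  define Z where "Z u v = (\<Sum>k<m. a u k * a v k)" for u v
  \<comment> \<open>The best scale is \<open>27/7\<close>, the total weight of the lines; the nearby
    integer 3 already suffices.\<close>
  have lower: "2 * 3 * (\<Sum>v<27::nat. 1 / 7) - 3\<^sup>2 \<le> (\<Sum>u<27. \<Sum>v<27. Z u v)"
    unfolding Z_def by (rule sum_inner_ge[OF cc]) (simp add: ac)
  have "0 \<le> (\<Sum>u<27. \<Sum>v<27. Z u v * (\<Sum>k<7. root_coord u k * root_coord v k))"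
    unfolding Z_def by (rule sum_kernels_nonneg)
  \<comment> \<open>The kernel is 48 on the diagonal, where \<open>Z\<close> is \<open>1/7\<close>,
    and -24 on meeting lines; on skew lines \<open>Z\<close> vanishes. Hence -24 serves everywhere,
    with the correction \<open>72/7\<close> on the diagonal.\<close>
  also have "\<dots> = (\<Sum>u<27. \<Sum>v<27. (if v = u then 72 / 7 else 0) - 24 * Z u v)"
  proof (intro sum.cong refl)
    fix u v :: nat assume "u \<in> {..<27}" "v \<in> {..<27}"
    then have uv: "u < 27" "v < 27" by simp_all
    consider "intersection (classes ! u) (classes ! v) = (if u = v then - 1 else 1)"
      | "u \<noteq> v" "orthogonal_in lines_scenario u v"
      using lines_intersection[OF uv] orthogonal_in_lines_scenario by blast
    then show "Z u v * (\<Sum>k<7. root_coord u k * root_coord v k)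
      = (if v = u then 72 / 7 else 0) - 24 * Z u v"
    proof cases
      case 1
      show ?thesis
        unfolding lines_kernel[OF uv] 1 using aa[of u] uv by (auto simp: Z_def)
    next
      case 2
      then show ?thesis using ao[of u v] by (simp add: Z_def)
    qed
  qed
  also have "\<dots> = 27 * (72 / 7) - 24 * (\<Sum>u<27. \<Sum>v<27. Z u v)"
    by (simp add: sum_subtractf flip: sum_distrib_left)
  finally show False using lower by simp
qed

theorem theorem7p4p3:
  shows "\<exists>H :: nat hypergraph. contextuality_scenario H \<and> Q1 H \<subset> CE_inf H"
  using lines_scenario Q1_subset_CE_inf[OF lines_scenario]
    uniform_model_in_CE_inf uniform_model_notin_Q1
  by blast

end
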